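(* Let $\mathcal{H}_1,\mathcal{H}_2$ be separable Hilbert spaces, let $(\psi_k)_{k\in K}$ be a Riesz basis for $\mathcal{H}_1$ and $(\phi_k)_{k\in K}$ a Riesz basis for $\mathcal{H}_2$, and let the symbol $m=(m_k)_{k\in K}$ be semi-normalized. Then $\mathbf{M}_{m,(\phi_k),(\psi_k)}$ is invertible and $$\mathbf{M}_{(m_k),(\phi_k),(\psi_k)}^{-1}=\mathbf{M}_{\left(\frac1{m_k}\right),(\tilde\psi_k),(\tilde\phi_k)} .$$
   Context: $K$ is a countable index set. Inner products are linear in the first argument. A complete sequence $(\psi_k)_{k\in K}$ in a Hilbert space $\mathcal{H}$ is a Riesz basis if there are $A,B>0$ with $A\|c\|_2^2\le\|\sum_k c_k\psi_k\|^2\le B\|c\|_2^2$ for all $c\in l^2(K)$. $(\tilde\psi_k)=(S^{-1}\psi_k)$ is the canonical dual, where $Sf=\sum_k\langle f,\psi_k\rangle\psi_k$; for a Riesz basis it is the unique sequence biorthogonal to $(\psi_k)$. Likewise for $(\tilde\phi_k)$. A scalar sequence $(m_k)$ is semi-normalized if $0<\inf_k|m_k|\le\sup_k|m_k|<\infty$. For Bessel sequences $(\beta_k)$ in $\mathcal{G}_1$, $(\alpha_k)$ in $\mathcal{G}_2$ and $m\in l^\infty(K)$, the multiplier $\mathbf{M}_{m,(\alpha_k),(\beta_k)}:\mathcal{G}_1\to\mathcal{G}_2$ is $f\mapsto\sum_k m_k\langle f,\beta_k\rangle\alpha_k$. *)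

theory Defs
  imports "HOL-Analysis.Analysis"
begin

section \<open>Complex Hilbert spaces\<close>

text \<open>
  The inner product is linear in its first argument. Positive definiteness of \<open>cinner\<close> follows
  from \<open>norm_eq_sqrt_cinner\<close> together with the norm axioms inherited from
  \<^class>\<open>real_normed_vector\<close>; \<open>cinner x x\<close> is real by \<open>cinner_commute\<close>.
\<close>

class complex_inner = real_normed_vector +
  fixes scaleC :: "complex \<Rightarrow> 'a \<Rightarrow> 'a" (infixr "*\<^sub>C" 75)
    and cinner :: "'a \<Rightarrow> 'a \<Rightarrow> complex"
  assumes scaleC_add_right: "a *\<^sub>C (x + y) = a *\<^sub>C x + a *\<^sub>C y"
    and scaleC_add_left: "(a + b) *\<^sub>C x = a *\<^sub>C x + b *\<^sub>C x"
    and scaleC_scaleC: "a *\<^sub>C b *\<^sub>C x = (a * b) *\<^sub>C x"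
    and scaleC_one: "1 *\<^sub>C x = x"
    and scaleR_scaleC: "r *\<^sub>R x = complex_of_real r *\<^sub>C x"
    and cinner_commute: "cinner x y = cnj (cinner y x)"
    and cinner_add_left: "cinner (x + y) z = cinner x z + cinner y z"
    and cinner_scaleC_left: "cinner (a *\<^sub>C x) y = a * cinner x y"
    and norm_eq_sqrt_cinner: "norm x = sqrt (Re (cinner x x))"

class complex_hilbert = complex_inner + banach

global_interpretation complex_vector:
  vector_space "scaleC :: complex \<Rightarrow> 'a \<Rightarrow> 'a :: complex_inner"
  by unfold_locales
    (simp_all add: scaleC_add_right scaleC_add_left scaleC_scaleC scaleC_one)

instantiation complex :: complex_hilbert
begin

definition scaleC_complex :: "complex \<Rightarrow> complex \<Rightarrow> complex" where
  "scaleC_complex a x = a * x"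

definition cinner_complex :: "complex \<Rightarrow> complex \<Rightarrow> complex" where
  "cinner_complex x y = x * cnj y"

instance
  by standard
    (simp_all add: scaleC_complex_def cinner_complex_def algebra_simps scaleR_conv_of_real
      cmod_def power2_eq_square)

end

definition bounded_clinear :: "('a::complex_inner \<Rightarrow> 'b::complex_inner) \<Rightarrow> bool" where
  "bounded_clinear f \<longleftrightarrow> bounded_linear f \<and> (\<forall>a x. f (a *\<^sub>C x) = a *\<^sub>C f x)"

definition invertible_op :: "('a::complex_inner \<Rightarrow> 'b::complex_inner) \<Rightarrow> bool" where
  "invertible_op f \<longleftrightarrow> bounded_clinear f \<and> bij f \<and> bounded_clinear (inv f)"


section \<open>Sequences indexed by a countable set and their multipliers\<close>

text \<open>
  A sequence over the index set \<open>K\<close> is a function on the index type of which only the values on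
  \<open>K\<close> matter. Series over \<open>K\<close>, which carries no order, converge unconditionally.
\<close>

definition l2_seq :: "'i set \<Rightarrow> ('i \<Rightarrow> complex) \<Rightarrow> bool" where
  "l2_seq K c \<longleftrightarrow> (\<lambda>k. (cmod (c k))\<^sup>2) summable_on K"

definition complete_seq :: "'i set \<Rightarrow> ('i \<Rightarrow> 'a::complex_inner) \<Rightarrow> bool" where
  "complete_seq K \<psi> \<longleftrightarrow> closure (complex_vector.span (\<psi> ` K)) = UNIV"

definition riesz_basis :: "'i set \<Rightarrow> ('i \<Rightarrow> 'a::complex_hilbert) \<Rightarrow> bool" where
  "riesz_basis K \<psi> \<longleftrightarrow> complete_seq K \<psi> \<and>
     (\<exists>A B. A > 0 \<and> B > 0 \<and>
       (\<forall>c. l2_seq K c \<longrightarrow>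
          (\<lambda>k. c k *\<^sub>C \<psi> k) summable_on K \<and>
          A * (\<Sum>\<^sub>\<infinity>k\<in>K. (cmod (c k))\<^sup>2) \<le> (norm (\<Sum>\<^sub>\<infinity>k\<in>K. c k *\<^sub>C \<psi> k))\<^sup>2 \<and>
          (norm (\<Sum>\<^sub>\<infinity>k\<in>K. c k *\<^sub>C \<psi> k))\<^sup>2 \<le> B * (\<Sum>\<^sub>\<infinity>k\<in>K. (cmod (c k))\<^sup>2)))"

definition frame_op :: "'i set \<Rightarrow> ('i \<Rightarrow> 'a::complex_hilbert) \<Rightarrow> 'a \<Rightarrow> 'a" where
  "frame_op K \<psi> f = (\<Sum>\<^sub>\<infinity>k\<in>K. cinner f (\<psi> k) *\<^sub>C \<psi> k)"

definition canonical_dual :: "'i set \<Rightarrow> ('i \<Rightarrow> 'a::complex_hilbert) \<Rightarrow> 'i \<Rightarrow> 'a" where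
  "canonical_dual K \<psi> k = inv (frame_op K \<psi>) (\<psi> k)"

text \<open>
  Infimum and supremum are taken in the complete lattice \<^typ>\<open>ereal\<close>, so that finiteness of the
  supremum is a genuine condition. The inequality between them is automatic for nonempty \<open>K\<close>.
\<close>

definition semi_normalized :: "'i set \<Rightarrow> ('i \<Rightarrow> complex) \<Rightarrow> bool" where
  "semi_normalized K m \<longleftrightarrow>
     0 < (INF k\<in>K. ereal (cmod (m k))) \<and> (SUP k\<in>K. ereal (cmod (m k))) < \<infinity>"

text \<open>
  The argument order follows the notation: symbol, synthesis sequence, analysis sequence. The
  definition is total; where the series diverges, the value is \<open>0\<close>. For a multiplier known to be
  linear and injective this cannot happen: divergence at \<open>f\<close> would give the value \<open>0\<close> at \<open>f\<close>,
  hence \<open>f = 0\<close>, where all terms vanish.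
\<close>

definition multiplier ::
    "'i set \<Rightarrow> ('i \<Rightarrow> complex) \<Rightarrow> ('i \<Rightarrow> 'b::complex_hilbert) \<Rightarrow> ('i \<Rightarrow> 'a::complex_hilbert) \<Rightarrow> 'a \<Rightarrow> 'b"
  where "multiplier K m \<alpha> \<beta> f = (\<Sum>\<^sub>\<infinity>k\<in>K. (m k * cinner f (\<beta> k)) *\<^sub>C \<alpha> k)"

end

theory Submission
  imports Defs
begin

text \<open>
  Write \<open>S\<close> for the frame operator, \<open>A\<close> for the lower Riesz bound and \<open>T d\<close> for the sum of the
  series \<open>d\<^sub>k \<psi>\<^sub>k\<close>. The operator \<open>S\<close> is bounded and satisfies \<open>A \<parallel>f\<parallel>\<^sup>2 \<le> \<langle>S f, f\<rangle>\<close>: on the span of the \<open>\<psi>\<^sub>k\<close> by the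
  Cauchy-Schwarz inequality for the coefficients, everywhere by density. Hence \<open>S\<close> is a bijection
  with bounded inverse (Lax-Milgram, through Banach's fixed point theorem). Applying the expansion
  \<open>h = S (S\<^sup>-\<^sup>1 h)\<close> to \<open>h = T d\<close> and comparing coefficients gives \<open>\<langle>S\<^sup>-\<^sup>1 (T d), \<psi>\<^sub>k\<rangle> = d\<^sub>k\<close>. As
  \<open>S\<^sup>-\<^sup>1\<close> is self-adjoint, the claimed inverse is the composition of \<open>S\<^sub>\<psi>\<^sup>-\<^sup>1\<close>, the multiplier with
  symbol \<open>1 / m\<close> from \<open>\<phi>\<close> to \<open>\<psi>\<close>, and \<open>S\<^sub>\<phi>\<^sup>-\<^sup>1\<close>; both products with the given multiplier
  then reduce to the identity by cancelling \<open>m\<^sub>k\<close> coefficientwise.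
\<close>

section \<open>Inner products and operators\<close>

lemma cinner_add_right: "cinner x (y + z) = cinner x y + cinner x z"
  for x :: "'a::complex_inner"
  by (metis cinner_add_left cinner_commute complex_cnj_add)

lemma cinner_scaleC_right: "cinner x (a *\<^sub>C y) = cnj a * cinner x y"
  for x :: "'a::complex_inner"
  by (metis cinner_commute cinner_scaleC_left complex_cnj_mult)

lemma cinner_scaleR_left: "cinner (r *\<^sub>R x) y = r *\<^sub>R cinner x y"
  for x :: "'a::complex_inner"
  by (simp add: scaleR_scaleC[where 'a = 'a] cinner_scaleC_left scaleR_conv_of_real)

lemma cinner_scaleR_right: "cinner x (r *\<^sub>R y) = r *\<^sub>R cinner x y"
  for x :: "'a::complex_inner"
  by (simp add: scaleR_scaleC[where 'a = 'a] cinner_scaleC_right scaleR_conv_of_real)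

lemma cinner_self: "cinner x x = complex_of_real ((norm x)\<^sup>2)"
  for x :: "'a::complex_inner"
proof -
  have "Im (cinner x x) = 0"
    by (metis cinner_commute cnj.simps(2) equal_neg_zero)
  moreover have "Re (cinner x x) = (norm x)\<^sup>2"
    by (metis norm_eq_sqrt_cinner norm_ge_zero real_sqrt_ge_0_iff real_sqrt_pow2)
  ultimately show ?thesis by (simp add: complex_eq_iff)
qed

lemma norm_scaleC: "norm (a *\<^sub>C x) = cmod a * norm x"
  for x :: "'a::complex_inner"
proof -
  have "complex_of_real ((norm (a *\<^sub>C x))\<^sup>2) = complex_of_real ((cmod a * norm x)\<^sup>2)"
    unfolding cinner_self[symmetric] cinner_scaleC_left cinner_scaleC_right
    by (simp add: cinner_self power_mult_distrib complex_norm_square[of a, simplified])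
  then have "(norm (a *\<^sub>C x))\<^sup>2 = (cmod a * norm x)\<^sup>2"
    using of_real_eq_iff by blast
  then show ?thesis
    by (rule power2_eq_imp_eq) auto
qed

lemma power2_norm_add: "(norm (x + y))\<^sup>2 = (norm x)\<^sup>2 + 2 * Re (cinner x y) + (norm y)\<^sup>2"
  for x :: "'a::complex_inner"
proof -
  have "complex_of_real ((norm (x + y))\<^sup>2)
      = of_real ((norm x)\<^sup>2) + (cinner x y + cnj (cinner x y)) + of_real ((norm y)\<^sup>2)"
    unfolding cinner_self[symmetric] cinner_add_left cinner_add_right
    by (simp add: cinner_commute[of y x])
  also have "\<dots> = of_real ((norm x)\<^sup>2 + 2 * Re (cinner x y) + (norm y)\<^sup>2)"
    by (simp add: complex_add_cnj)
  finally show ?thesis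
    using of_real_eq_iff by blast
qed

text \<open>The triangle inequality already holds for the norm, so squaring it and expanding bounds
  the real part of the inner product; rotating \<open>x\<close> by a scalar turns this into a bound
  on the modulus.\<close>

lemma cinner_cauchy_schwarz: "cmod (cinner x y) \<le> norm x * norm y"
  for x :: "'a::complex_inner"
proof -
  have Re_le: "Re (cinner u y) \<le> norm u * norm y" for u :: 'a
  proof -
    have "(norm (u + y))\<^sup>2 \<le> (norm u + norm y)\<^sup>2"
      by (intro power_mono norm_triangle_ineq norm_ge_zero)
    then show ?thesis
      unfolding power2_norm_add by (simp add: power2_sum)
  qed
  \<comment> \<open>\<open>a\<close> rotates the inner product onto the nonnegative real axis. It is
    \<open>0\<close> when the inner product vanishes, so only \<open>cmod a\<close> \<le>
    \<open>1\<close> is available in general.\<close>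
  define a where "a = cnj (sgn (cinner x y))"
  have "a * cinner x y = cmod (cinner x y)"
    by (cases "cinner x y = 0")
      (simp_all add: a_def sgn_eq complex_norm_square[symmetric] mult.commute power2_eq_square)
  then have "cmod (cinner x y) = Re (cinner (a *\<^sub>C x) y)"
    by (simp add: cinner_scaleC_left)
  also have "\<dots> \<le> cmod a * norm x * norm y"
    using Re_le[of "a *\<^sub>C x"] by (simp add: norm_scaleC)
  also have "\<dots> \<le> 1 * norm x * norm y"
    by (intro mult_right_mono) (auto simp: a_def norm_sgn)
  finally show ?thesis by simp
qed

lemma bounded_linear_cinner_left: "bounded_linear (\<lambda>x :: 'a::complex_inner. cinner x y)"
  by (rule bounded_linear_intro[where K = "norm y"])
    (auto simp: cinner_add_left cinner_scaleR_left cinner_cauchy_schwarz)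

lemma bounded_linear_cinner_right: "bounded_linear (cinner (x :: 'a::complex_inner))"
  by (rule bounded_linear_intro[where K = "norm x"])
    (auto simp: cinner_add_right cinner_scaleR_right mult.commute[of "norm _" "norm x"]
      cinner_cauchy_schwarz)

lemma bounded_linear_scaleC_right: "bounded_linear (\<lambda>x :: 'a::complex_inner. a *\<^sub>C x)"
  by (rule bounded_linear_intro[where K = "cmod a"])
    (auto simp: scaleC_add_right scaleR_scaleC scaleC_scaleC mult.commute norm_scaleC)

section \<open>Bounded complex-linear operators and their inverses\<close>

lemma bounded_clinearI:
  assumes "\<And>x y. f (x + y) = f x + f y"
    and "\<And>a x. f (a *\<^sub>C x) = a *\<^sub>C f x"
    and "\<And>x. norm (f x) \<le> norm x * C"
  shows "bounded_clinear f"
  unfolding bounded_clinear_def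
  using assms by (auto intro!: bounded_linear_intro[where K = C] simp: scaleR_scaleC)

lemma bounded_clinear_compose:
  "bounded_clinear f \<Longrightarrow> bounded_clinear g \<Longrightarrow> bounded_clinear (\<lambda>x. f (g x))"
  by (auto simp: bounded_clinear_def intro: bounded_linear_compose)

lemma bounded_clinear_inv:
  assumes f: "bounded_clinear f" and bij: "bij f"
    and C: "C > 0" "\<And>x. C * norm x \<le> norm (f x)"
  shows "bounded_clinear (inv f)"
proof (rule bounded_clinearI)
  interpret f: bounded_linear f
    using f by (simp add: bounded_clinear_def)
  have f_inv: "f (inv f y) = y" for y
    using bij by (simp add: bij_is_surj surj_f_inv_f)
  have inv_f: "inv f y = x" if "f x = y" for x y
    using bij that by (metis bij_is_inj inv_f_f)
  show "inv f (x + y) = inv f x + inv f y" for x y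
    by (intro inv_f) (simp add: f.add f_inv)
  show "inv f (a *\<^sub>C x) = a *\<^sub>C inv f x" for a x
    using f by (intro inv_f) (simp add: bounded_clinear_def f_inv)
  show "norm (inv f y) \<le> norm y * (1 / C)" for y
    using C(2)[of "inv f y"] C(1) by (simp add: f_inv field_simps)
qed

text \<open>Cauchy-Schwarz turns coercivity into a lower bound on \<open>norm (S f)\<close>, which
  gives injectivity and a bounded inverse. For surjectivity, a solution of \<open>S f = g\<close> is
  a fixed point of the map sending \<open>f\<close> to \<open>f - t *\<^sub>R (S f - g)\<close>, a
  contraction for suitable \<open>t > 0\<close>.\<close>

lemma lax_milgram:
  fixes S :: "'a::complex_hilbert \<Rightarrow> 'a"
  assumes S: "bounded_clinear S" and A: "A > 0"
    and coercive: "\<And>f. A * (norm f)\<^sup>2 \<le> Re (cinner (S f) f)"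
  shows "bij S" "bounded_clinear (inv S)"
proof -
  interpret S: bounded_linear S
    using S by (simp add: bounded_clinear_def)
  have lower: "A * norm f \<le> norm (S f)" for f
  proof (cases "f = 0")
    case False
    have "A * norm f * norm f \<le> norm (S f) * norm f"
      using coercive[of f] complex_Re_le_cmod[of "cinner (S f) f"] cinner_cauchy_schwarz[of "S f" f]
      by (simp add: power2_eq_square)
    then show ?thesis using False by simp
  qed simp
  have "inj S"
  proof (rule injI)
    fix x y assume "S x = S y"
    then have "S (x - y) = 0" by (simp add: S.diff)
    then show "x = y" using lower[of "x - y"] A by (simp add: mult_le_0_iff)
  qed
  moreover have "surj S"
  proof (rule surjI)
    fix g
    obtain B0 where B0: "\<And>f. norm (S f) \<le> norm f * B0"
      using S.bounded by blast
    \<comment> \<open>Enlarging the bound to at least \<open>A\<close> makes \<open>B\<close>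
      positive and \<open>A / B\<close> \<le> \<open>1\<close>, so that \<open>q\<close> below lies
      in \<open>[0, 1)\<close>.\<close>
    define B where "B = max B0 A"
    have B: "norm (S f) \<le> B * norm f" for f
      using B0[of f] mult_left_mono[of B0 B "norm f"] by (simp add: B_def mult.commute)
    have AB: "0 < A" "A \<le> B"
      using A by (auto simp: B_def)
    define t where "t = A / B\<^sup>2"
    define q where "q = 1 - (A / B)\<^sup>2"
    have t: "t > 0" using AB by (simp add: t_def)
    have AB1: "0 < A / B" "A / B \<le> 1" using AB by auto
    then have q: "0 \<le> q" "q < 1"
      by (auto simp: q_def power_le_one)
    \<comment> \<open>this choice of \<open>t\<close> minimizes \<open>1 - 2 * t * A + t\<^sup>2 * B\<^sup>2\<close>, with minimum \<open>q\<close>\<close>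
    have contr: "norm (f - t *\<^sub>R S f) \<le> sqrt q * norm f" for f
    proof -
      have "(norm (f + (- t) *\<^sub>R S f))\<^sup>2
          = (norm f)\<^sup>2 - 2 * t * Re (cinner (S f) f) + t\<^sup>2 * (norm (S f))\<^sup>2"
        unfolding power2_norm_add cinner_scaleR_right
        by (simp add: cinner_commute[of f] power_mult_distrib)
      also have "\<dots> \<le> (norm f)\<^sup>2 - 2 * t * (A * (norm f)\<^sup>2) + t\<^sup>2 * (B * norm f)\<^sup>2"
        using coercive[of f] B[of f] t
        by (intro add_mono diff_mono mult_left_mono power_mono) auto
      also have "\<dots> = q * (norm f)\<^sup>2"
        using AB by (simp add: t_def q_def field_simps power2_eq_square)
      finally have "sqrt ((norm (f - t *\<^sub>R S f))\<^sup>2) \<le> sqrt (q * (norm f)\<^sup>2)"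
        by (intro real_sqrt_le_mono) simp
      then show ?thesis by (simp add: real_sqrt_mult)
    qed
    have "\<exists>!f. f - t *\<^sub>R (S f - g) = f"
    proof (rule banach_fix_type[where c = "sqrt q"], goal_cases)
      case 3
      have "dist (x - t *\<^sub>R (S x - g)) (y - t *\<^sub>R (S y - g)) \<le> sqrt q * dist x y" for x y
        using contr[of "x - y"] by (simp add: dist_norm S.diff algebra_simps)
      then show ?case by blast
    qed (use q in auto)
    then have "\<exists>f. S f = g" using t by auto
    then show "S (SOME f. S f = g) = g" by (rule someI_ex)
  qed
  ultimately show "bij S" by (simp add: bij_def)
  then show "bounded_clinear (inv S)"
    using bounded_clinear_inv[OF S _ A lower] by blast
qed


section \<open>Square-summable coefficients and Riesz bases\<close>

lemma l2_seq_diff: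
  assumes "l2_seq K c" "l2_seq K d"
  shows "l2_seq K (\<lambda>k. c k - d k)"
  unfolding l2_seq_def
proof (rule summable_on_comparison_test)
  show "(\<lambda>k. 2 * (cmod (c k))\<^sup>2 + 2 * (cmod (d k))\<^sup>2) summable_on K"
    using assms unfolding l2_seq_def by (intro summable_on_add summable_on_cmult_right)
  fix k
  have "(cmod (c k - d k))\<^sup>2 \<le> (cmod (c k) + cmod (d k))\<^sup>2"
    by (intro power_mono norm_triangle_ineq4) auto
  also have "\<dots> \<le> 2 * (cmod (c k))\<^sup>2 + 2 * (cmod (d k))\<^sup>2"
    using sum_squares_bound[of "cmod (c k)" "cmod (d k)"] by (simp add: power2_sum)
  finally show "(cmod (c k - d k))\<^sup>2 \<le> 2 * (cmod (c k))\<^sup>2 + 2 * (cmod (d k))\<^sup>2" .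
qed auto

lemma l2_seq_weighted:
  assumes c: "l2_seq K c" and w: "\<And>k. k \<in> K \<Longrightarrow> cmod (w k) \<le> W"
  shows "l2_seq K (\<lambda>k. w k * c k)"
    and "(\<Sum>\<^sub>\<infinity>k\<in>K. (cmod (w k * c k))\<^sup>2) \<le> W\<^sup>2 * (\<Sum>\<^sub>\<infinity>k\<in>K. (cmod (c k))\<^sup>2)"
proof -
  have sm: "(\<lambda>k. W\<^sup>2 * (cmod (c k))\<^sup>2) summable_on K"
    using c unfolding l2_seq_def by (rule summable_on_cmult_right)
  have le: "(cmod (w k * c k))\<^sup>2 \<le> W\<^sup>2 * (cmod (c k))\<^sup>2" if "k \<in> K" for k
    using w[OF that] by (auto simp: norm_mult power_mult_distrib intro!: mult_right_mono power_mono)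
  show l2: "l2_seq K (\<lambda>k. w k * c k)"
    unfolding l2_seq_def by (rule summable_on_comparison_test[OF sm]) (use le in auto)
  have "(\<Sum>\<^sub>\<infinity>k\<in>K. (cmod (w k * c k))\<^sup>2) \<le> (\<Sum>\<^sub>\<infinity>k\<in>K. W\<^sup>2 * (cmod (c k))\<^sup>2)"
    using l2 by (intro infsum_mono sm le) (simp add: l2_seq_def)
  then show "(\<Sum>\<^sub>\<infinity>k\<in>K. (cmod (w k * c k))\<^sup>2) \<le> W\<^sup>2 * (\<Sum>\<^sub>\<infinity>k\<in>K. (cmod (c k))\<^sup>2)"
    by (simp add: infsum_cmult_right')
qed

text \<open>Lets the Riesz inequalities, stated for series over \<open>K\<close>, be applied to
  finite linear combinations.\<close>

lemma has_sum_finite_support: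
  assumes "finite F" "F \<subseteq> K" "\<And>k. k \<notin> F \<Longrightarrow> f k = 0"
  shows "(f has_sum sum f F) K"
proof -
  have "(f has_sum sum f F) F"
    using assms(1) by (rule has_sum_finite)
  then show ?thesis
    by (rule has_sum_cong_neutral[THEN iffD1, rotated -1]) (use assms in auto)
qed

lemma riesz_basis_summable:
  "riesz_basis K \<psi> \<Longrightarrow> l2_seq K c \<Longrightarrow> (\<lambda>k. c k *\<^sub>C \<psi> k) summable_on K"
  unfolding riesz_basis_def by blast

lemma riesz_basis_lower_bound:
  assumes "riesz_basis K \<psi>"
  obtains A where "A > 0" "\<And>c. l2_seq K c \<Longrightarrow>
    A * (\<Sum>\<^sub>\<infinity>k\<in>K. (cmod (c k))\<^sup>2) \<le> (norm (\<Sum>\<^sub>\<infinity>k\<in>K. c k *\<^sub>C \<psi> k))\<^sup>2"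
  using assms unfolding riesz_basis_def by blast

lemma riesz_basis_upper_bound:
  assumes "riesz_basis K \<psi>"
  obtains B where "B > 0" "\<And>c. l2_seq K c \<Longrightarrow>
    (norm (\<Sum>\<^sub>\<infinity>k\<in>K. c k *\<^sub>C \<psi> k))\<^sup>2 \<le> B * (\<Sum>\<^sub>\<infinity>k\<in>K. (cmod (c k))\<^sup>2)"
  using assms unfolding riesz_basis_def by blast

text \<open>The lower Riesz bound, applied to \<open>c - d\<close>, forces its square sum to vanish,
  hence every term on \<open>K\<close>.\<close>

lemma riesz_basis_unique:
  assumes rb: "riesz_basis K \<psi>" and c: "l2_seq K c" and d: "l2_seq K d"
    and eq: "(\<Sum>\<^sub>\<infinity>k\<in>K. c k *\<^sub>C \<psi> k) = (\<Sum>\<^sub>\<infinity>k\<in>K. d k *\<^sub>C \<psi> k)"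
    and k: "k \<in> K"
  shows "c k = d k"
proof -
  obtain A where A: "A > 0" "\<And>c. l2_seq K c \<Longrightarrow>
      A * (\<Sum>\<^sub>\<infinity>k\<in>K. (cmod (c k))\<^sup>2) \<le> (norm (\<Sum>\<^sub>\<infinity>k\<in>K. c k *\<^sub>C \<psi> k))\<^sup>2"
    using riesz_basis_lower_bound[OF rb] by blast
  have cd: "l2_seq K (\<lambda>k. c k - d k)"
    using c d by (rule l2_seq_diff)
  have "((\<lambda>k. - (d k *\<^sub>C \<psi> k)) has_sum - (\<Sum>\<^sub>\<infinity>k\<in>K. d k *\<^sub>C \<psi> k)) K"
    using has_sum_infsum[OF riesz_basis_summable[OF rb d]] by (simp add: has_sum_uminus)
  then have "((\<lambda>k. c k *\<^sub>C \<psi> k - d k *\<^sub>C \<psi> k) has_sum 0) K"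
    using has_sum_add[OF has_sum_infsum[OF riesz_basis_summable[OF rb c]]] eq by fastforce
  then have "(\<Sum>\<^sub>\<infinity>k\<in>K. (c k - d k) *\<^sub>C \<psi> k) = 0"
    by (simp add: complex_vector.scale_left_diff_distrib infsumI)
  then have "(\<Sum>\<^sub>\<infinity>k\<in>K. (cmod (c k - d k))\<^sup>2) \<le> 0"
    using A(2)[OF cd] A(1) by (simp add: mult_le_0_iff)
  then have "(cmod (c k - d k))\<^sup>2 = 0"
    using cd k nonneg_infsum_le_0D[of "\<lambda>k. (cmod (c k - d k))\<^sup>2" K k] by (simp add: l2_seq_def)
  then show ?thesis by simp
qed

text \<open>A duality argument: the partial square sum \<open>s\<close> over a finite
  \<open>F\<close> equals the inner product of \<open>f\<close> with \<open>g\<close>, the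
  combination of the \<open>\<psi> k\<close> whose coefficients are those of \<open>f\<close>.
  Cauchy-Schwarz and the upper Riesz bound for \<open>g\<close> give
  \<open>s\<^sup>2 \<le> B * (norm f)\<^sup>2 * s\<close>. Dividing by \<open>s\<close> leaves a
  bound uniform in \<open>F\<close>, hence summability.\<close>

lemma riesz_basis_bessel:
  fixes \<psi> :: "'i \<Rightarrow> 'a::complex_hilbert"
  assumes rb: "riesz_basis K \<psi>"
  obtains B where "B > 0" "\<And>f. l2_seq K (\<lambda>k. cinner f (\<psi> k))"
    "\<And>f. (\<Sum>\<^sub>\<infinity>k\<in>K. (cmod (cinner f (\<psi> k)))\<^sup>2) \<le> B * (norm f)\<^sup>2"
proof -
  obtain B where B: "B > 0" "\<And>c. l2_seq K c \<Longrightarrow>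
      (norm (\<Sum>\<^sub>\<infinity>k\<in>K. c k *\<^sub>C \<psi> k))\<^sup>2 \<le> B * (\<Sum>\<^sub>\<infinity>k\<in>K. (cmod (c k))\<^sup>2)"
    using riesz_basis_upper_bound[OF rb] by blast
  have fin: "(\<Sum>k\<in>F. (cmod (cinner f (\<psi> k)))\<^sup>2) \<le> B * (norm f)\<^sup>2"
    if F: "finite F" "F \<subseteq> K" for f F
  proof -
    define s where "s = (\<Sum>k\<in>F. (cmod (cinner f (\<psi> k)))\<^sup>2)"
    have s0: "s \<ge> 0" by (simp add: s_def sum_nonneg)
    \<comment> \<open>Extension by zero outside \<open>F\<close> turns the finite family into a
      square-summable sequence over \<open>K\<close>.\<close>
    define c where "c k = (if k \<in> F then cinner f (\<psi> k) else 0)" for k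
    define g where "g = (\<Sum>k\<in>F. c k *\<^sub>C \<psi> k)"
    have "((\<lambda>k. (cmod (c k))\<^sup>2) has_sum (\<Sum>k\<in>F. (cmod (c k))\<^sup>2)) K"
      by (rule has_sum_finite_support[OF F]) (simp add: c_def)
    then have c: "l2_seq K c" and cs: "(\<Sum>\<^sub>\<infinity>k\<in>K. (cmod (c k))\<^sup>2) = s"
      by (auto simp: l2_seq_def c_def s_def infsumI dest: has_sum_imp_summable)
    have "((\<lambda>k. c k *\<^sub>C \<psi> k) has_sum g) K"
      unfolding g_def by (rule has_sum_finite_support[OF F]) (simp add: c_def)
    then have "(norm g)\<^sup>2 \<le> B * s"
      using B(2)[OF c] cs by (simp add: infsumI)
    then have g: "norm g \<le> sqrt (B * s)"
      by (rule real_le_rsqrt)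
    have "cinner f g = (\<Sum>k\<in>F. cnj (c k) * cinner f (\<psi> k))"
      unfolding g_def
      by (simp add: linear_sum[OF bounded_linear.linear[OF bounded_linear_cinner_right]]
          cinner_scaleC_right)
    also have "\<dots> = of_real s"
      unfolding s_def of_real_sum
      by (rule sum.cong) (auto simp: c_def complex_norm_square[simplified] mult.commute)
    finally have "s = cmod (cinner f g)" using s0 by simp
    also have "\<dots> \<le> norm f * sqrt (B * s)"
      using cinner_cauchy_schwarz[of f g] mult_left_mono[OF g, of "norm f"] by simp
    finally have "s\<^sup>2 \<le> (norm f * sqrt (B * s))\<^sup>2"
      using s0 by (rule power_mono)
    also have "\<dots> = (B * (norm f)\<^sup>2) * s"
      using B(1) s0 by (simp add: power_mult_distrib)
    finally have "s * s \<le> (B * (norm f)\<^sup>2) * s"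
      by (simp add: power2_eq_square)
    then show ?thesis
      using s0 B(1) unfolding s_def[symmetric] by (cases "s = 0") auto
  qed
  have l2: "l2_seq K (\<lambda>k. cinner f (\<psi> k))" for f
    unfolding l2_seq_def
    by (rule nonneg_bdd_above_summable_on) (auto intro!: bdd_aboveI2[where M = "B * (norm f)\<^sup>2"] fin)
  have "(\<Sum>\<^sub>\<infinity>k\<in>K. (cmod (cinner f (\<psi> k)))\<^sup>2) \<le> B * (norm f)\<^sup>2" for f
    using l2[of f] unfolding l2_seq_def by (rule infsum_le_finite_sums) (use fin in auto)
  with that B(1) l2 show ?thesis by blast
qed

section \<open>Multipliers between Riesz bases\<close>

lemma riesz_basis_l2_analysis: "riesz_basis K \<psi> \<Longrightarrow> l2_seq K (\<lambda>k. cinner f (\<psi> k))"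
  using riesz_basis_bessel by blast

text \<open>Guarantees that the value of the multiplier is the limit of its series and not the
  default \<open>0\<close> of a divergent one: the coefficients stay square-summable under a bounded
  symbol.\<close>

lemma multiplier_has_sum:
  assumes \<psi>: "riesz_basis K \<psi>" and \<phi>: "riesz_basis K \<phi>"
    and w: "\<And>k. k \<in> K \<Longrightarrow> cmod (w k) \<le> W"
  shows "((\<lambda>k. (w k * cinner f (\<psi> k)) *\<^sub>C \<phi> k) has_sum multiplier K w \<phi> \<psi> f) K"
  unfolding multiplier_def
  by (intro has_sum_infsum riesz_basis_summable[OF \<phi>]
      l2_seq_weighted(1)[OF riesz_basis_l2_analysis[OF \<psi>] w])

text \<open>The multiplier is analysis by \<psi>, multiplication by \<open>w\<close> and synthesis
  by \<phi>. The squared bounds of these three steps are \<open>B\<close>, \<open>W\<^sup>2\<close>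
  and \<open>D\<close>, which explains the constant in the norm estimate.\<close>

lemma bounded_clinear_multiplier:
  assumes \<psi>: "riesz_basis K \<psi>" and \<phi>: "riesz_basis K \<phi>"
    and w: "\<And>k. k \<in> K \<Longrightarrow> cmod (w k) \<le> W"
  shows "bounded_clinear (multiplier K w \<phi> \<psi>)"
proof -
  have sums: "((\<lambda>k. (w k * cinner f (\<psi> k)) *\<^sub>C \<phi> k) has_sum multiplier K w \<phi> \<psi> f) K" for f
    using \<psi> \<phi> w by (rule multiplier_has_sum)
  obtain B where B: "B > 0" "\<And>f. l2_seq K (\<lambda>k. cinner f (\<psi> k))"
      "\<And>f. (\<Sum>\<^sub>\<infinity>k\<in>K. (cmod (cinner f (\<psi> k)))\<^sup>2) \<le> B * (norm f)\<^sup>2"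
    by (rule riesz_basis_bessel[OF \<psi>]) (rule that; blast)
  obtain D where D: "D > 0" "\<And>c. l2_seq K c \<Longrightarrow>
      (norm (\<Sum>\<^sub>\<infinity>k\<in>K. c k *\<^sub>C \<phi> k))\<^sup>2 \<le> D * (\<Sum>\<^sub>\<infinity>k\<in>K. (cmod (c k))\<^sup>2)"
    using riesz_basis_upper_bound[OF \<phi>] by blast
  show ?thesis
  proof (rule bounded_clinearI)
    show "multiplier K w \<phi> \<psi> (f + g) = multiplier K w \<phi> \<psi> f + multiplier K w \<phi> \<psi> g" for f g
      using has_sum_unique[OF sums[of "f + g"]] has_sum_add[OF sums[of f] sums[of g]]
      by (simp add: cinner_add_left distrib_left scaleC_add_left)
    show "multiplier K w \<phi> \<psi> (a *\<^sub>C f) = a *\<^sub>C multiplier K w \<phi> \<psi> f" for a f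
      using has_sum_unique[OF sums[of "a *\<^sub>C f"]]
        has_sum_bounded_linear[OF bounded_linear_scaleC_right[of a] sums[of f]]
      by (simp add: cinner_scaleC_left scaleC_scaleC mult.left_commute o_def)
    show "norm (multiplier K w \<phi> \<psi> f) \<le> norm f * sqrt (D * (W\<^sup>2 * B))" for f
    proof -
      note l2 = l2_seq_weighted[OF riesz_basis_l2_analysis[OF \<psi>, of f], of w W, OF w]
      have "(norm (multiplier K w \<phi> \<psi> f))\<^sup>2 \<le> D * (\<Sum>\<^sub>\<infinity>k\<in>K. (cmod (w k * cinner f (\<psi> k)))\<^sup>2)"
        unfolding multiplier_def by (rule D(2)) (rule l2(1))
      also have "\<dots> \<le> D * (W\<^sup>2 * (\<Sum>\<^sub>\<infinity>k\<in>K. (cmod (cinner f (\<psi> k)))\<^sup>2))"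
        using D(1) l2(2) by (intro mult_left_mono) auto
      also have "\<dots> \<le> D * (W\<^sup>2 * (B * (norm f)\<^sup>2))"
        using D(1) B(3) by (intro mult_left_mono) auto
      also have "\<dots> = (D * (W\<^sup>2 * B)) * (norm f)\<^sup>2" by simp
      finally have "norm (multiplier K w \<phi> \<psi> f) \<le> sqrt ((D * (W\<^sup>2 * B)) * (norm f)\<^sup>2)"
        by (rule real_le_rsqrt)
      then show ?thesis
        by (simp only: real_sqrt_mult[of _ "(norm f)\<^sup>2"] real_sqrt_abs abs_norm_cancel
            mult.commute[of "norm f"])
    qed
  qed
qed


section \<open>The frame operator of a Riesz basis\<close>

lemma frame_op_eq_multiplier: "frame_op K \<psi> = multiplier K (\<lambda>_. 1) \<psi> \<psi>"
  by (simp add: fun_eq_iff frame_op_def multiplier_def)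

lemma bounded_clinear_frame_op: "riesz_basis K \<psi> \<Longrightarrow> bounded_clinear (frame_op K \<psi>)"
  unfolding frame_op_eq_multiplier by (rule bounded_clinear_multiplier[where W = 1]) auto

lemma frame_op_has_sum:
  "riesz_basis K \<psi> \<Longrightarrow> ((\<lambda>k. cinner f (\<psi> k) *\<^sub>C \<psi> k) has_sum frame_op K \<psi> f) K"
  unfolding frame_op_def by (intro has_sum_infsum riesz_basis_summable riesz_basis_l2_analysis)

lemma cinner_frame_op_has_sum:
  assumes "riesz_basis K \<psi>"
  shows "((\<lambda>k. cinner f (\<psi> k) * cinner (\<psi> k) g) has_sum cinner (frame_op K \<psi> f) g) K"
  using has_sum_bounded_linear[OF bounded_linear_cinner_left frame_op_has_sum[OF assms]]
  by (simp add: o_def cinner_scaleC_left)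

text \<open>Conjugating the series for \<open>cinner (frame_op K \<psi> g) f\<close> term by term
  yields the series for the left-hand side.\<close>

lemma frame_op_selfadjoint:
  assumes "riesz_basis K \<psi>"
  shows "cinner (frame_op K \<psi> f) g = cinner f (frame_op K \<psi> g)"
proof -
  have "((\<lambda>k. cnj (cinner g (\<psi> k) * cinner (\<psi> k) f)) has_sum cnj (cinner (frame_op K \<psi> g) f)) K"
    using has_sum_bounded_linear[OF bounded_linear_cnj cinner_frame_op_has_sum[OF assms]]
    by (simp add: o_def)
  then have "((\<lambda>k. cinner f (\<psi> k) * cinner (\<psi> k) g) has_sum cinner f (frame_op K \<psi> g)) K"
    by (simp add: cinner_commute[symmetric] mult.commute)
  then show ?thesis
    using cinner_frame_op_has_sum[OF assms] has_sum_unique by blast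
qed

lemma cinner_frame_op_self_has_sum:
  assumes "riesz_basis K \<psi>"
  shows "((\<lambda>k. (cmod (cinner f (\<psi> k)))\<^sup>2) has_sum Re (cinner (frame_op K \<psi> f) f)) K"
proof -
  have "Re (cinner f (\<psi> k) * cinner (\<psi> k) f) = (cmod (cinner f (\<psi> k)))\<^sup>2" for k
    by (metis Re_complex_of_real cinner_commute complex_norm_square)
  then show ?thesis
    using has_sum_bounded_linear[OF bounded_linear_Re cinner_frame_op_has_sum[OF assms, of f f]]
    by (simp add: o_def)
qed

text \<open>Span elements are combinations of vectors in the image of \<psi>. Choosing one index for
  each vector involved turns them into combinations over indices, even if \<psi> repeats
  vectors.\<close>

lemma riesz_basis_span:
  fixes \<psi> :: "'i \<Rightarrow> 'a::complex_hilbert"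
  assumes "f \<in> complex_vector.span (\<psi> ` K)"
  obtains F c where "finite F" "F \<subseteq> K" "\<And>k. k \<notin> F \<Longrightarrow> c k = 0" "f = (\<Sum>k\<in>F. c k *\<^sub>C \<psi> k)"
proof -
  obtain t r where t: "finite t" "t \<subseteq> \<psi> ` K" and f: "f = (\<Sum>a\<in>t. r a *\<^sub>C a)"
    using assms unfolding complex_vector.span_explicit by blast
  obtain F where F: "F \<subseteq> K" "finite F" "t = \<psi> ` F" "inj_on \<psi> F"
    using t by (metis finite_imageD subset_image_inj)
  have "f = (\<Sum>k\<in>F. (if k \<in> F then r (\<psi> k) else 0) *\<^sub>C \<psi> k)"
    unfolding f F(3) by (simp add: sum.reindex[OF F(4)])
  then show ?thesis
    using that[of F "\<lambda>k. if k \<in> F then r (\<psi> k) else 0"] F by simp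
qed

text \<open>For a finite combination \<open>f\<close> with coefficients \<open>c\<close>, let
  \<open>s\<close> be the square sum of \<open>c\<close> and \<open>u\<close> the quadratic form of
  the frame operator at \<open>f\<close>. Pairing \<open>f\<close> with its own expansion gives
  \<open>(norm f) ^ 4 \<le> s * u\<close>, and the lower Riesz bound gives
  \<open>A * s \<le> (norm f)\<^sup>2\<close>. Together they yield
  \<open>A * (norm f)\<^sup>2 \<le> u\<close>, a closed condition on \<open>f\<close>.\<close>

lemma frame_op_coercive:
  fixes \<psi> :: "'i \<Rightarrow> 'a::complex_hilbert"
  assumes rb: "riesz_basis K \<psi>"
  obtains A where "A > 0" "\<And>f. A * (norm f)\<^sup>2 \<le> Re (cinner (frame_op K \<psi> f) f)"
proof -
  obtain A where A: "A > 0" "\<And>c. l2_seq K c \<Longrightarrow>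
      A * (\<Sum>\<^sub>\<infinity>k\<in>K. (cmod (c k))\<^sup>2) \<le> (norm (\<Sum>\<^sub>\<infinity>k\<in>K. c k *\<^sub>C \<psi> k))\<^sup>2"
    using riesz_basis_lower_bound[OF rb] by blast
  let ?C = "{f. A * (norm f)\<^sup>2 \<le> Re (cinner (frame_op K \<psi> f) f)}"
  have "f \<in> ?C" if span: "f \<in> complex_vector.span (\<psi> ` K)" for f
  proof -
    obtain F c where F: "finite F" "F \<subseteq> K" and c0: "\<And>k. k \<notin> F \<Longrightarrow> c k = 0"
      and f: "f = (\<Sum>k\<in>F. c k *\<^sub>C \<psi> k)"
      by (rule riesz_basis_span[OF span]) blast
    define s where "s = (\<Sum>k\<in>F. (cmod (c k))\<^sup>2)"
    define u where "u = Re (cinner (frame_op K \<psi> f) f)"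
    have s: "((\<lambda>k. (cmod (c k))\<^sup>2) has_sum s) K"
      unfolding s_def by (rule has_sum_finite_support[OF F]) (simp add: c0)
    have "((\<lambda>k. c k *\<^sub>C \<psi> k) has_sum f) K"
      unfolding f by (rule has_sum_finite_support[OF F]) (simp add: c0)
    then have As: "A * s \<le> (norm f)\<^sup>2"
      using A(2)[of c] s by (simp add: l2_seq_def infsumI has_sum_imp_summable[OF s])
    have u: "(\<Sum>k\<in>F. (cmod (cinner f (\<psi> k)))\<^sup>2) \<le> u"
      using cinner_frame_op_self_has_sum[OF rb, of f] F unfolding u_def
      by (auto intro: finite_sum_le_has_sum)
    have "cinner f f = (\<Sum>k\<in>F. cnj (c k) * cinner f (\<psi> k))"
      by (subst (2) f)
        (simp add: linear_sum[OF bounded_linear.linear[OF bounded_linear_cinner_right]]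
          cinner_scaleC_right)
    then have "(norm f)\<^sup>2 = cmod (\<Sum>k\<in>F. cnj (c k) * cinner f (\<psi> k))"
      by (metis abs_power2 cinner_self norm_of_real real_norm_def)
    also have "\<dots> \<le> (\<Sum>k\<in>F. \<bar>cmod (c k)\<bar> * \<bar>cmod (cinner f (\<psi> k))\<bar>)"
      by (rule order_trans[OF norm_sum]) (simp add: norm_mult)
    also have "\<dots> \<le> sqrt s * sqrt (\<Sum>k\<in>F. (cmod (cinner f (\<psi> k)))\<^sup>2)"
      using L2_set_mult_ineq[of "\<lambda>k. cmod (c k)" "\<lambda>k. cmod (cinner f (\<psi> k))" F]
      by (simp add: L2_set_def s_def)
    also have "\<dots> \<le> sqrt s * sqrt u"
      using u by (intro mult_left_mono) (auto simp: s_def sum_nonneg)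
    finally have "((norm f)\<^sup>2)\<^sup>2 \<le> (sqrt s * sqrt u)\<^sup>2"
      by (rule power_mono) simp
    moreover have "s \<ge> 0" "u \<ge> 0"
      by (auto simp: s_def sum_nonneg intro: order_trans[OF _ u])
    ultimately have "(norm f)\<^sup>2 * (norm f)\<^sup>2 \<le> s * u"
      by (simp add: power_mult_distrib power2_eq_square[of "(norm f)\<^sup>2"])
    then have "A * (norm f)\<^sup>2 * (norm f)\<^sup>2 \<le> A * s * u"
      using A(1) by (simp add: mult.assoc)
    also have "\<dots> \<le> (norm f)\<^sup>2 * u"
      using As \<open>u \<ge> 0\<close> by (intro mult_right_mono)
    finally have "(norm f)\<^sup>2 * (A * (norm f)\<^sup>2) \<le> (norm f)\<^sup>2 * u"
      by (simp add: mult.commute)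
    then have "A * (norm f)\<^sup>2 \<le> u"
      using \<open>u \<ge> 0\<close> by (cases "f = 0") auto
    then show ?thesis by (simp add: u_def)
  qed
  moreover have "closed ?C"
  proof (rule closed_Collect_le)
    interpret S: bounded_linear "frame_op K \<psi>"
      using bounded_clinear_frame_op[OF rb] by (simp add: bounded_clinear_def)
    \<comment> \<open>Writing the quadratic form through norms reduces its continuity to that of the
      norm and of the frame operator.\<close>
    have eq: "Re (cinner (frame_op K \<psi> f) f)
        = ((norm (frame_op K \<psi> f + f))\<^sup>2 - (norm (frame_op K \<psi> f))\<^sup>2 - (norm f)\<^sup>2) / 2" for f
      by (simp add: power2_norm_add)
    show "continuous_on UNIV (\<lambda>f. Re (cinner (frame_op K \<psi> f) f))"
      unfolding eq by (intro continuous_intros S.continuous_on) auto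
    show "continuous_on UNIV (\<lambda>f::'a. A * (norm f)\<^sup>2)"
      by (intro continuous_intros)
  qed
  ultimately have "closure (complex_vector.span (\<psi> ` K)) \<subseteq> ?C"
    by (intro closure_minimal) blast
  then have "f \<in> ?C" for f
    using rb unfolding riesz_basis_def complete_seq_def by blast
  then show ?thesis
    using that A(1) by blast
qed

lemma
  assumes rb: "riesz_basis K \<psi>"
  shows bij_frame_op: "bij (frame_op K \<psi>)"
    and bounded_clinear_inv_frame_op: "bounded_clinear (inv (frame_op K \<psi>))"
proof -
  obtain A where "A > 0" "\<And>f. A * (norm f)\<^sup>2 \<le> Re (cinner (frame_op K \<psi> f) f)"
    using frame_op_coercive[OF rb] by blast
  then show "bij (frame_op K \<psi>)" "bounded_clinear (inv (frame_op K \<psi>))"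
    using lax_milgram[OF bounded_clinear_frame_op[OF rb]] by blast+
qed

lemma frame_op_inv: "riesz_basis K \<psi> \<Longrightarrow> frame_op K \<psi> (inv (frame_op K \<psi>) f) = f"
  by (simp add: bij_frame_op bij_is_surj surj_f_inv_f)

lemma inv_frame_op: "riesz_basis K \<psi> \<Longrightarrow> inv (frame_op K \<psi>) (frame_op K \<psi> f) = f"
  by (simp add: bij_frame_op bij_is_inj inv_f_f)

text \<open>Write \<open>f\<close> as the frame operator applied to its preimage and move the
  operator across the inner product, where it cancels the inverse in the dual vector.\<close>

lemma cinner_canonical_dual:
  assumes "riesz_basis K \<psi>"
  shows "cinner f (canonical_dual K \<psi> k) = cinner (inv (frame_op K \<psi>) f) (\<psi> k)"
  unfolding canonical_dual_def by (metis assms frame_op_inv frame_op_selfadjoint)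

text \<open>Biorthogonality of \<psi> and its dual, extended to square-summable combinations. Both
  coefficient sequences synthesize the same vector, so uniqueness identifies them.\<close>

lemma cinner_inv_frame_op_synthesis:
  assumes rb: "riesz_basis K \<psi>" and d: "l2_seq K d" and k: "k \<in> K"
  shows "cinner (inv (frame_op K \<psi>) (\<Sum>\<^sub>\<infinity>k\<in>K. d k *\<^sub>C \<psi> k)) (\<psi> k) = d k"
proof (rule riesz_basis_unique[OF rb riesz_basis_l2_analysis[OF rb] d _ k])
  let ?h = "\<Sum>\<^sub>\<infinity>k\<in>K. d k *\<^sub>C \<psi> k"
  show "(\<Sum>\<^sub>\<infinity>k\<in>K. cinner (inv (frame_op K \<psi>) ?h) (\<psi> k) *\<^sub>C \<psi> k) = ?h"
    unfolding frame_op_def[of K \<psi> "inv (frame_op K \<psi>) ?h", symmetric] by (rule frame_op_inv[OF rb])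
qed


section \<open>Inverting the multiplier\<close>

text \<open>The continuous inverse of the frame operator of \<psi> is pulled out of a series already
  known to converge, so convergence of the series in the dual vectors comes with it.\<close>

lemma multiplier_canonical_dual:
  assumes \<psi>: "riesz_basis K \<psi>" and \<phi>: "riesz_basis K \<phi>"
    and w: "\<And>k. k \<in> K \<Longrightarrow> cmod (w k) \<le> W"
  shows "multiplier K w (canonical_dual K \<psi>) (canonical_dual K \<phi>) g =
    inv (frame_op K \<psi>) (multiplier K w \<psi> \<phi> (inv (frame_op K \<phi>) g))"
proof -
  have S: "bounded_linear (inv (frame_op K \<psi>))"
    "inv (frame_op K \<psi>) (a *\<^sub>C x) = a *\<^sub>C inv (frame_op K \<psi>) x" for a x
    using bounded_clinear_inv_frame_op[OF \<psi>] by (auto simp: bounded_clinear_def)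
  have "((\<lambda>k. (w k * cinner g (canonical_dual K \<phi> k)) *\<^sub>C canonical_dual K \<psi> k) has_sum
      inv (frame_op K \<psi>) (multiplier K w \<psi> \<phi> (inv (frame_op K \<phi>) g))) K"
    using has_sum_bounded_linear[OF S(1) multiplier_has_sum[OF \<phi> \<psi> w, where f = "inv (frame_op K \<phi>) g"]]
    by (simp add: o_def S(2) cinner_canonical_dual[OF \<phi>] canonical_dual_def[of K \<psi>])
  then show ?thesis
    unfolding multiplier_def[of K w "canonical_dual K \<psi>"] by (rule infsumI)
qed

text \<open>The inverse frame operator recovers the coefficients
  \<open>v k * cinner f (\<phi> k)\<close>. The factor \<open>w k\<close> then cancels
  \<open>v k\<close>, leaving the frame series of \<phi>. Keeping \<open>v\<close> and
  \<open>w\<close> general serves both products with the claimed inverse.\<close>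

lemma multiplier_inv_frame_op_multiplier:
  assumes \<psi>: "riesz_basis K \<psi>" and \<phi>: "riesz_basis K \<phi>"
    and v: "\<And>k. k \<in> K \<Longrightarrow> cmod (v k) \<le> V"
    and vw: "\<And>k. k \<in> K \<Longrightarrow> w k * v k = 1"
  shows "multiplier K w \<phi> \<psi> (inv (frame_op K \<psi>) (multiplier K v \<psi> \<phi> f)) = frame_op K \<phi> f"
proof -
  have l2: "l2_seq K (\<lambda>k. v k * cinner f (\<phi> k))"
    using riesz_basis_l2_analysis[OF \<phi>] v by (rule l2_seq_weighted)
  have "w k * cinner (inv (frame_op K \<psi>) (multiplier K v \<psi> \<phi> f)) (\<psi> k) = cinner f (\<phi> k)"
    if k: "k \<in> K" for k
    unfolding multiplier_def cinner_inv_frame_op_synthesis[OF \<psi> l2 k]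
    using vw[OF k] by (simp add: mult.assoc[symmetric])
  then show ?thesis
    unfolding multiplier_def[of K w] frame_op_def[of K \<phi>] by (intro infsum_cong) simp
qed

text \<open>Real bounds are interpolated strictly between the extended-real quantities, since
  infimum and supremum are themselves infinite for empty \<open>K\<close>.\<close>

lemma semi_normalized_bounds:
  assumes "semi_normalized K m"
  obtains a b where "a > 0" "\<And>k. k \<in> K \<Longrightarrow> a \<le> cmod (m k)" "\<And>k. k \<in> K \<Longrightarrow> cmod (m k) \<le> b"
proof -
  obtain a where a: "0 < ereal a" "ereal a < (INF k\<in>K. ereal (cmod (m k)))"
    using assms ereal_dense2 unfolding semi_normalized_def by blast
  obtain b where b: "(SUP k\<in>K. ereal (cmod (m k))) < ereal b"
    using assms ereal_dense2 unfolding semi_normalized_def by blast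
  show ?thesis
  proof (rule that)
    show "a > 0" using a by simp
    show "a \<le> cmod (m k)" if "k \<in> K" for k
      using a(2) INF_lower[OF that, of "\<lambda>k. ereal (cmod (m k))"] by (auto dest: less_le_trans)
    show "cmod (m k) \<le> b" if "k \<in> K" for k
      using b SUP_upper[OF that, of "\<lambda>k. ereal (cmod (m k))"] by (auto dest: le_less_trans)
  qed
qed

theorem proposition7p7:
  fixes K :: "'i set"
    and \<psi> :: "'i \<Rightarrow> 'a::complex_hilbert"
    and \<phi> :: "'i \<Rightarrow> 'b::complex_hilbert"
    and m :: "'i \<Rightarrow> complex"
  assumes "countable K"
    and "separable_space (euclidean :: 'a topology)"
    and "separable_space (euclidean :: 'b topology)"
    and "riesz_basis K \<psi>"
    and "riesz_basis K \<phi>"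
    and "semi_normalized K m"
  shows "invertible_op (multiplier K m \<phi> \<psi>) \<and>
    inv (multiplier K m \<phi> \<psi>) =
      multiplier K (\<lambda>k. 1 / m k) (canonical_dual K \<psi>) (canonical_dual K \<phi>)"
proof -
  note \<psi> = assms(4) and \<phi> = assms(5)
  obtain a b where a: "a > 0" "\<And>k. k \<in> K \<Longrightarrow> a \<le> cmod (m k)"
    and b: "\<And>k. k \<in> K \<Longrightarrow> cmod (m k) \<le> b"
    using semi_normalized_bounds[OF assms(6)] by blast
  have w: "cmod (1 / m k) \<le> 1 / a" if "k \<in> K" for k
    using a(1) a(2)[OF that] by (simp add: norm_divide frac_le)
  have nz: "m k \<noteq> 0" if "k \<in> K" for k
    using a(1) a(2)[OF that] by auto
  let ?M = "multiplier K m \<phi> \<psi>"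
  let ?N = "multiplier K (\<lambda>k. 1 / m k) (canonical_dual K \<psi>) (canonical_dual K \<phi>)"
  have N: "?N g = inv (frame_op K \<psi>) (multiplier K (\<lambda>k. 1 / m k) \<psi> \<phi> (inv (frame_op K \<phi>) g))" for g
    using \<psi> \<phi> w by (rule multiplier_canonical_dual)
  \<comment> \<open>The middle factors collapse to the frame operator of \<phi>, which meets its
    inverse at \<open>g\<close>.\<close>
  have MN: "?M (?N g) = g" for g
    unfolding N
    by (subst multiplier_inv_frame_op_multiplier[OF \<psi> \<phi> w]) (simp_all add: nz frame_op_inv[OF \<phi>])
  \<comment> \<open>The same cancellation with \<psi> and \<phi> exchanged and \<open>m\<close> as
    the inner symbol leaves the frame operator of \<psi> under its inverse.\<close>
  have NM: "?N (?M f) = f" for f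
    unfolding N
    by (subst multiplier_inv_frame_op_multiplier[OF \<phi> \<psi> b]) (simp_all add: nz inv_frame_op[OF \<psi>])
  have bij: "bij ?M"
    by (rule o_bij[of ?N]) (auto simp: NM MN)
  have inv: "inv ?M = ?N"
    using NM MN by (intro inv_equality)
  have "bounded_clinear ?N"
    unfolding N[abs_def]
    by (intro bounded_clinear_compose[OF bounded_clinear_inv_frame_op[OF \<psi>]]
        bounded_clinear_compose[OF bounded_clinear_multiplier[OF \<phi> \<psi> w]]
        bounded_clinear_inv_frame_op[OF \<phi>])
  moreover have "bounded_clinear ?M"
    using \<psi> \<phi> b by (rule bounded_clinear_multiplier)
  ultimately show ?thesis
    using bij inv by (simp add: invertible_op_def)
qed

end
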